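(* Let $F:\mathbb{R}^d\to\mathbb{R}$ be twice continuously differentiable and suppose there exist positive constants $\mu, L$ such that $\mu I \preceq \nabla^2 F(w) \preceq L I$ for all $w\in\mathbb{R}^d$. Let $F^\star = F(w^\star)$, where $w^\star$ is the minimizer of $F$. Let $\{w_k\}$ be the iterates generated by the sampled LBFGS (S-LBFGS) method from the starting point $w_0$, i.e. $w_{k+1} = w_k - \alpha_k H_k\nabla F(w_k)$ with $H_k$ the S-LBFGS inverse Hessian approximations, and let $0<\mu_1\le\mu_2$ be constants such that $\mu_1 I\preceq H_k\preceq \mu_2 I$ for all $k=0,1,2,\dots$. Suppose the step length is constant, with $$0<\alpha_k=\alpha\le \frac{\mu_1}{\mu_2^2L}.$$ Then, for all $k\ge 0$, $$F(w_k)-F^\star\le (1-\alpha\mu\mu_1)^k\,[F(w_0)-F^\star].$$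
   Context: S-LBFGS method with memory $m\ge 1$ and sampling radius $r>0$. At iteration $k$, given $w_k$: for $j=1,\dots,m$ sample a (nonzero, otherwise arbitrary) random direction $\sigma_j\in\mathbb{R}^d$, set $\bar w_j=w_k+r\sigma_j$, $s_{k,j}=w_k-\bar w_j$, and either $y_{k,j}=\nabla F(w_k)-\nabla F(\bar w_j)$ (Option I) or $y_{k,j}=\nabla^2F(w_k)s_{k,j}$ (Option II). The results hold for both options. The inverse Hessian approximation is $H_k=B_k^{-1}$, where $B_k=B_k^{(m)}$ is obtained from $B_k^{(0)}=\frac{y_{k,l}^Ty_{k,l}}{s_{k,l}^Ty_{k,l}}I$ (with $l$ chosen uniformly at random from $\{1,\dots,m\}$) by the updates, for $i=1,\dots,m$, $$B_k^{(i)}=B_k^{(i-1)}-\frac{B_k^{(i-1)}s_{k,i}s_{k,i}^TB_k^{(i-1)}}{s_{k,i}^TB_k^{(i-1)}s_{k,i}}+\frac{y_{k,i}y_{k,i}^T}{y_{k,i}^Ts_{k,i}}.$$ Then $w_{k+1}=w_k-\alpha_kH_k\nabla F(w_k)$ with step length $\alpha_k>0$. $A\preceq B$ means $B-A$ is positive semidefinite. Constants $\mu_1,\mu_2$ as in the claim are known to exist under the stated hypotheses on $F$. *)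

theory Defs
  imports "HOL-Analysis.Analysis"
begin

definition gradient :: "(real^'n \<Rightarrow> real) \<Rightarrow> real^'n \<Rightarrow> real^'n" where
  "gradient F w = (THE g. GDERIV F w :> g)"

lemma gradient_eqI:
  assumes "GDERIV F w :> g"
  shows "gradient F w = g"
  unfolding gradient_def
proof (rule the_equality)
  show "GDERIV F w :> g" by (rule assms)
next
  fix g' assume "GDERIV F w :> g'"
  then have "(\<lambda>h. h \<bullet> g') = (\<lambda>h. h \<bullet> g)"
    using assms unfolding gderiv_def by (rule has_derivative_unique)
  then show "g' = g"
    by (metis inner_commute vector_eq_rdot)
qed

lemma GDERIV_gradient:
  fixes F :: "real^'n \<Rightarrow> real"
  assumes "F differentiable (at w)"
  shows "GDERIV F w :> gradient F w"
proof -
  obtain D where D: "(F has_derivative D) (at w)"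
    using assms by (auto simp: differentiable_def)
  then have "linear D"
    by (rule has_derivative_linear)
  then have "D h = h \<bullet> adjoint D 1" for h
    by (simp add: adjoint_works)
  then have "D = (\<lambda>h. h \<bullet> adjoint D 1)"
    by blast
  then have "GDERIV F w :> adjoint D 1"
    using D unfolding gderiv_def by simp
  then show ?thesis
    using gradient_eqI by metis
qed

definition hessian :: "(real^'n \<Rightarrow> real) \<Rightarrow> real^'n \<Rightarrow> real^'n^'n" where
  "hessian F w = jacobian (gradient F) (at w)"

definition twice_continuously_differentiable :: "(real^'n \<Rightarrow> real) \<Rightarrow> bool" where
  "twice_continuously_differentiable F \<longleftrightarrow>
     (\<forall>w. F differentiable (at w)) \<and>
     (\<forall>w. gradient F differentiable (at w)) \<and>
     continuous_on UNIV (hessian F)"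

text \<open>As usual for real matrices, positive semidefiniteness includes symmetry.\<close>

definition pos_semidef :: "real^'n^'n \<Rightarrow> bool" where
  "pos_semidef A \<longleftrightarrow> transpose A = A \<and> (\<forall>x. 0 \<le> x \<bullet> (A *v x))"

definition loewner_le :: "real^'n^'n \<Rightarrow> real^'n^'n \<Rightarrow> bool" (infix \<open>\<preceq>\<close> 50) where
  "A \<preceq> B \<longleftrightarrow> pos_semidef (B - A)"

text \<open>The rank-one matrix \<open>u v\<^sup>T\<close>.\<close>

definition outer :: "real^'n \<Rightarrow> real^'n \<Rightarrow> real^'n^'n" where
  "outer u v = (\<chi> i j. u $ i * v $ j)"

text \<open>
  \<open>s\<close> and \<open>y\<close> are the sequences of curvature pairs, of which only the entries with
  indices \<open>1, \<dots>, m\<close> are used; \<open>l\<close> is the index used for the initial scaling.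
\<close>

primrec bfgs_B :: "(nat \<Rightarrow> real^'n) \<Rightarrow> (nat \<Rightarrow> real^'n) \<Rightarrow> nat \<Rightarrow> nat \<Rightarrow> real^'n^'n" where
  "bfgs_B s y l 0 = ((y l \<bullet> y l) / (s l \<bullet> y l)) *\<^sub>R mat 1"
| "bfgs_B s y l (Suc i) =
     (let B = bfgs_B s y l i; s' = s (Suc i); y' = y (Suc i) in
      B - (1 / (s' \<bullet> (B *v s'))) *\<^sub>R (B ** outer s' s' ** B)
        + (1 / (y' \<bullet> s')) *\<^sub>R outer y' y')"

text \<open>Option I uses differences of gradients, Option II uses Hessian-vector products.\<close>

datatype curvature_variant = OptionI | OptionII

text \<open>
  \<open>\<sigma> 1, \<dots>, \<sigma> m\<close> are the sampled directions of one iteration with current point \<open>w\<close>.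
\<close>

definition sample_point :: "real \<Rightarrow> real^'n \<Rightarrow> (nat \<Rightarrow> real^'n) \<Rightarrow> nat \<Rightarrow> real^'n" where
  "sample_point r w \<sigma> j = w + r *\<^sub>R \<sigma> j"

definition pair_s :: "real \<Rightarrow> real^'n \<Rightarrow> (nat \<Rightarrow> real^'n) \<Rightarrow> nat \<Rightarrow> real^'n" where
  "pair_s r w \<sigma> j = w - sample_point r w \<sigma> j"

definition pair_y :: "curvature_variant \<Rightarrow> (real^'n \<Rightarrow> real) \<Rightarrow> real \<Rightarrow> real^'n \<Rightarrow>
    (nat \<Rightarrow> real^'n) \<Rightarrow> nat \<Rightarrow> real^'n" where
  "pair_y opt F r w \<sigma> j =
     (case opt of
        OptionI \<Rightarrow> gradient F w - gradient F (sample_point r w \<sigma> j)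
      | OptionII \<Rightarrow> hessian F w *v pair_s r w \<sigma> j)"

definition slbfgs_H :: "curvature_variant \<Rightarrow> (real^'n \<Rightarrow> real) \<Rightarrow> nat \<Rightarrow> real \<Rightarrow> real^'n \<Rightarrow>
    (nat \<Rightarrow> real^'n) \<Rightarrow> nat \<Rightarrow> real^'n^'n" where
  "slbfgs_H opt F m r w \<sigma> l =
     matrix_inv (bfgs_B (pair_s r w \<sigma>) (pair_y opt F r w \<sigma>) l m)"

text \<open>
  The iterates for one realization of the random choices: \<open>\<sigma> k j\<close> is the \<open>j\<close>-th direction
  sampled in iteration \<open>k\<close>, and \<open>l k\<close> the index drawn in iteration \<open>k\<close>. Results that hold
  for all values of \<open>\<sigma>\<close> and \<open>l\<close> hold for every realization, whatever the distribution.
\<close>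

primrec slbfgs_iterate :: "curvature_variant \<Rightarrow> (real^'n \<Rightarrow> real) \<Rightarrow> nat \<Rightarrow> real \<Rightarrow>
    (nat \<Rightarrow> nat \<Rightarrow> real^'n) \<Rightarrow> (nat \<Rightarrow> nat) \<Rightarrow> (nat \<Rightarrow> real) \<Rightarrow> real^'n \<Rightarrow> nat \<Rightarrow> real^'n" where
  "slbfgs_iterate opt F m r \<sigma> l \<alpha> w0 0 = w0"
| "slbfgs_iterate opt F m r \<sigma> l \<alpha> w0 (Suc k) =
     (let w = slbfgs_iterate opt F m r \<sigma> l \<alpha> w0 k in
      w - \<alpha> k *\<^sub>R (slbfgs_H opt F m r w (\<sigma> k) (l k) *v gradient F w))"

end

theory Submission
  imports Defs
begin

text \<open>
  Taylor's formula along segments gives the quadratic lower bound with constant \<open>\<mu>\<close> and the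
  quadratic upper bound with constant \<open>L\<close>. Minimizing the lower bound gives the
  Polyak--Lojasiewicz inequality \<open>2\<mu>(F - F\<^sup>\<star>) \<le> |g|\<^sup>2\<close> for the gradient \<open>g\<close>. Since
  \<open>|H g|\<^sup>2 \<le> \<mu>\<^sub>2 (g \<bullet> H g)\<close> and \<open>\<alpha> L \<mu>\<^sub>2 \<le> 1\<close>, the upper bound shows that one step decreases
  \<open>F\<close> by at least \<open>\<alpha>/2 (g \<bullet> H g) \<ge> \<alpha>\<mu>\<^sub>1/2 |g|\<^sup>2 \<ge> \<alpha>\<mu>\<mu>\<^sub>1 (F - F\<^sup>\<star>)\<close>.
\<close>

text \<open>Maclaurin's formula with Lagrange remainder, applied to the restriction of
  \<open>F\<close> to the line through \<open>v\<close> in direction \<open>h\<close>; the witness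
  \<open>u\<close> is a point on the open segment from \<open>v\<close> to
  \<open>v + h\<close>.\<close>

lemma twice_differentiable_Taylor_segment:
  fixes F :: "real^'n \<Rightarrow> real"
  assumes F: "\<And>v. F differentiable (at v)"
    and G: "\<And>v. gradient F differentiable (at v)"
  shows "\<exists>u. F (v + h) = F v + h \<bullet> gradient F v + (h \<bullet> (hessian F u *v h)) / 2"
proof -
  define f where "f = (\<lambda>t::real. F (v + t *\<^sub>R h))"
  define f' where "f' = (\<lambda>t::real. h \<bullet> gradient F (v + t *\<^sub>R h))"
  define f'' where "f'' = (\<lambda>t::real. h \<bullet> (hessian F (v + t *\<^sub>R h) *v h))"
  have line: "((\<lambda>t. v + t *\<^sub>R h) has_derivative (\<lambda>t. t *\<^sub>R h)) (at t)" for t :: real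
    by (auto intro!: derivative_eq_intros)
  have d1: "(f has_real_derivative f' t) (at t)" for t
  proof -
    have "(F has_derivative (\<lambda>k. k \<bullet> gradient F (v + t *\<^sub>R h))) (at (v + t *\<^sub>R h))"
      using GDERIV_gradient[OF F] unfolding gderiv_def .
    from has_derivative_compose[OF line this]
    show ?thesis
      unfolding f_def f'_def has_field_derivative_def by (simp add: mult.commute[of _ "h \<bullet> _"])
  qed
  have d2: "(f' has_real_derivative f'' t) (at t)" for t
  proof -
    have "(gradient F has_derivative (\<lambda>k. hessian F (v + t *\<^sub>R h) *v k)) (at (v + t *\<^sub>R h))"
      using G jacobian_works unfolding hessian_def by blast
    from has_derivative_inner_right[OF has_derivative_compose[OF line this], of h]
    show ?thesis
      unfolding f'_def f''_def has_field_derivative_def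
      by (simp add: matrix_vector_mult_scaleR mult.commute[of _ "h \<bullet> _"])
  qed
  \<comment> \<open>\<open>Maclaurin\<close> expects a whole sequence of derivatives but inspects
    only the indices 0, 1, 2, so \<open>f''\<close> is a harmless default beyond that.\<close>
  define diff where "diff = (\<lambda>n::nat. if n = 0 then f else if n = 1 then f' else f'')"
  have "\<exists>t>0. t < 1 \<and> f 1 = (\<Sum>n<2. diff n 0 / fact n * 1 ^ n) + diff 2 t / fact 2 * 1 ^ 2"
  proof (rule Maclaurin)
    show "\<forall>n t. n < 2 \<and> 0 \<le> t \<and> t \<le> 1 \<longrightarrow> DERIV (diff n) t :> diff (Suc n) t"
      using d1 d2 by (auto simp: diff_def less_2_cases_iff)
  qed (auto simp: diff_def)
  then obtain t where "f 1 = f 0 + f' 0 + f'' t / 2"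
    by (auto simp: diff_def eval_nat_numeral)
  then show ?thesis
    unfolding f_def f'_def f''_def by auto
qed

lemma loewner_le_quadratic_form:
  assumes "A \<preceq> B"
  shows "x \<bullet> (A *v x) \<le> x \<bullet> (B *v x)"
  using assms
  by (simp add: loewner_le_def pos_semidef_def matrix_vector_mult_diff_rdistrib inner_diff_right)

lemma scaleR_mat_loewner_le:
  assumes "c *\<^sub>R mat 1 \<preceq> A"
  shows "c * (x \<bullet> x) \<le> x \<bullet> (A *v x)"
  using loewner_le_quadratic_form[OF assms, of x] by (simp add: scaleR_matrix_vector_assoc[symmetric])

lemma loewner_le_scaleR_mat:
  assumes "A \<preceq> c *\<^sub>R mat 1"
  shows "x \<bullet> (A *v x) \<le> c * (x \<bullet> x)"
  using loewner_le_quadratic_form[OF assms, of x] by (simp add: scaleR_matrix_vector_assoc[symmetric])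

text \<open>Symmetry is part of \<open>pos_semidef\<close>, so it passes from \<open>c I - A\<close>
  to \<open>A\<close>. It is what allows \<open>A\<close> to be moved across an inner
  product.\<close>

lemma loewner_le_scaleR_mat_transpose:
  assumes "A \<preceq> c *\<^sub>R mat 1"
  shows "transpose A = A"
proof -
  have entry: "(transpose (c *\<^sub>R mat 1 - A)) $ i $ j = (c *\<^sub>R mat 1 - A) $ i $ j" for i j
    using assms by (simp add: loewner_le_def pos_semidef_def)
  have "A $ j $ i = A $ i $ j" for i j
    by (cases "i = j") (use entry[of i j] in \<open>simp_all add: transpose_def mat_def\<close>)
  then show ?thesis
    by (simp add: vec_eq_iff transpose_def)
qed

text \<open>The bound follows by evaluating the form of \<open>A\<close> at \<open>x - A x / c\<close>, where it is nonnegative.\<close>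

lemma norm_matrix_vector_le_quadratic_form:
  fixes A :: "real^'n^'n"
  assumes nonneg: "\<And>x. 0 \<le> x \<bullet> (A *v x)" and le: "A \<preceq> c *\<^sub>R mat 1" and c: "0 < c"
  shows "(A *v x) \<bullet> (A *v x) \<le> c * (x \<bullet> (A *v x))"
proof -
  let ?y = "A *v x"
  have sym: "x \<bullet> (A *v ?y) = ?y \<bullet> ?y"
    by (metis dot_lmul_matrix inner_commute le loewner_le_scaleR_mat_transpose transpose_matrix_vector)
  have "0 \<le> (c *\<^sub>R x - ?y) \<bullet> (A *v (c *\<^sub>R x - ?y))"
    by (rule nonneg)
  also have "\<dots> = c * c * (x \<bullet> ?y) - 2 * c * (?y \<bullet> ?y) + ?y \<bullet> (A *v ?y)"
    using sym by (simp add: matrix_vector_mult_diff_distrib matrix_vector_mult_scaleR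
        inner_diff_left inner_diff_right algebra_simps)
  \<comment> \<open>The upper bound on \<open>A\<close> is used at the vector \<open>A x\<close>,
    which turns the coefficient \<open>-2c\<close> of \<open>|A x|^2\<close> into
    \<open>-c\<close>.\<close>
  also have "\<dots> \<le> c * c * (x \<bullet> ?y) - 2 * c * (?y \<bullet> ?y) + c * (?y \<bullet> ?y)"
    using loewner_le_scaleR_mat[OF le] by simp
  finally have "c * (?y \<bullet> ?y) \<le> c * (c * (x \<bullet> ?y))"
    by (simp add: algebra_simps)
  with c show ?thesis by simp
qed

lemma Polyak_Lojasiewicz:
  fixes F :: "real^'n \<Rightarrow> real"
  assumes lower: "\<And>h. F v + h \<bullet> g + \<mu> / 2 * (h \<bullet> h) \<le> F (v + h)" and \<mu>: "0 < \<mu>"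
  shows "2 * \<mu> * (F v - F u) \<le> g \<bullet> g"
proof -
  obtain h where u: "u = v + h"
    by (metis add.commute diff_add_cancel)
  \<comment> \<open>Completing the square replaces the minimization over \<open>h\<close>: this
    square vanishes exactly at the minimizer \<open>-g/\<mu>\<close> of the lower bound.\<close>
  have "0 \<le> (\<mu> *\<^sub>R h + g) \<bullet> (\<mu> *\<^sub>R h + g)" by simp
  also have "\<dots> = 2 * \<mu> * (h \<bullet> g + \<mu> / 2 * (h \<bullet> h)) + g \<bullet> g"
    by (simp add: inner_add_left inner_add_right inner_commute[of g h] algebra_simps)
  also have "\<dots> \<le> 2 * \<mu> * (F u - F v) + g \<bullet> g"
    using lower[of h] \<mu> unfolding u by (simp add: mult_left_mono)
  finally show ?thesis by (simp add: algebra_simps)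
qed

lemma quasi_newton_step_decrease:
  fixes F :: "real^'n \<Rightarrow> real" and H :: "real^'n^'n"
  assumes upper: "\<And>h. F (v + h) \<le> F v + h \<bullet> g + L / 2 * (h \<bullet> h)"
    and H: "\<mu>\<^sub>1 *\<^sub>R mat 1 \<preceq> H" "H \<preceq> \<mu>\<^sub>2 *\<^sub>R mat 1"
    and pos: "0 < \<mu>\<^sub>1" "0 < \<mu>\<^sub>2" "0 < L"
    and \<alpha>: "0 < \<alpha>" "\<alpha> * L * \<mu>\<^sub>2 \<le> 1"
  shows "F (v - \<alpha> *\<^sub>R (H *v g)) \<le> F v - \<alpha> * \<mu>\<^sub>1 / 2 * (g \<bullet> g)"
proof -
  let ?q = "g \<bullet> (H *v g)"
  have q: "\<mu>\<^sub>1 * (x \<bullet> x) \<le> x \<bullet> (H *v x)" for x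
    using H(1) by (rule scaleR_mat_loewner_le)
  then have nonneg: "0 \<le> x \<bullet> (H *v x)" for x
    using pos(1) by (meson inner_ge_zero less_imp_le mult_nonneg_nonneg order_trans)
  have "F (v - \<alpha> *\<^sub>R (H *v g)) \<le> F v - \<alpha> * ?q + \<alpha> * \<alpha> * L / 2 * ((H *v g) \<bullet> (H *v g))"
    using upper[of "- (\<alpha> *\<^sub>R (H *v g))"] by (simp add: inner_commute[of g] algebra_simps)
  \<comment> \<open>Bounding \<open>|H g|^2\<close> by a multiple of \<open>g \<bullet> H g\<close>,
    not of \<open>|g|^2\<close>, makes the first- and second-order terms comparable; as \<alpha> L
    \<open>\<mu>\<^sub>2\<close> is at most 1, the latter costs at most half of the
    decrease.\<close>
  also have "\<dots> \<le> F v - \<alpha> * ?q + \<alpha> * \<alpha> * L / 2 * (\<mu>\<^sub>2 * ?q)"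
    using norm_matrix_vector_le_quadratic_form[OF nonneg H(2) pos(2)] pos \<alpha>
    by (intro add_left_mono mult_left_mono) auto
  also have "\<dots> = F v - \<alpha> * ?q + (\<alpha> * L * \<mu>\<^sub>2) * (\<alpha> / 2 * ?q)"
    by (simp add: algebra_simps)
  also have "\<dots> \<le> F v - \<alpha> * ?q + 1 * (\<alpha> / 2 * ?q)"
    using \<alpha> nonneg by (intro add_left_mono mult_right_mono) auto
  also have "\<dots> = F v - \<alpha> / 2 * ?q"
    by simp
  also have "\<dots> \<le> F v - \<alpha> / 2 * (\<mu>\<^sub>1 * (g \<bullet> g))"
    using q \<alpha> by (intro diff_left_mono mult_left_mono) auto
  finally show ?thesis by (simp add: mult.assoc)
qed

text \<open>Both forms are compared at a unit vector. Applied to the Hessian, this yields \<mu>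
  \<le> L.\<close>

lemma loewner_bounds_scaleR_mat_le:
  fixes A :: "real^'n^'n"
  assumes "a *\<^sub>R mat 1 \<preceq> A" "A \<preceq> b *\<^sub>R mat 1"
  shows "a \<le> b"
proof -
  obtain e :: "real^'n" where "norm e = 1"
    using vector_choose_size[of 1] by auto
  then have "e \<bullet> e = 1"
    by (simp add: norm_eq_1)
  then show ?thesis
    using scaleR_mat_loewner_le[OF assms(1), of e] loewner_le_scaleR_mat[OF assms(2), of e] by simp
qed

theorem theorem5p2:
  fixes F :: "real^'n \<Rightarrow> real"
    and \<mu> L \<mu>\<^sub>1 \<mu>\<^sub>2 r \<alpha> :: real
    and m :: nat
    and opt :: curvature_variant
    and \<sigma> :: "nat \<Rightarrow> nat \<Rightarrow> real^'n"
    and l :: "nat \<Rightarrow> nat"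
    and \<alpha>s :: "nat \<Rightarrow> real"
    and w0 wstar :: "real^'n"
    and w :: "nat \<Rightarrow> real^'n"
    and H :: "nat \<Rightarrow> real^'n^'n"
  assumes "twice_continuously_differentiable F"
    and "0 < \<mu>" and "0 < L"
    and "\<And>v. \<mu> *\<^sub>R mat 1 \<preceq> hessian F v \<and> hessian F v \<preceq> L *\<^sub>R mat 1"
    and "\<And>v. F wstar \<le> F v"
    and "1 \<le> m" and "0 < r"
    and "\<And>k j. j \<in> {1..m} \<Longrightarrow> \<sigma> k j \<noteq> 0"
    and "\<And>k. l k \<in> {1..m}"
    and "w = slbfgs_iterate opt F m r \<sigma> l \<alpha>s w0"
    and "H = (\<lambda>k. slbfgs_H opt F m r (w k) (\<sigma> k) (l k))"
    and "0 < \<mu>\<^sub>1" and "\<mu>\<^sub>1 \<le> \<mu>\<^sub>2"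
    and "\<And>k. \<mu>\<^sub>1 *\<^sub>R mat 1 \<preceq> H k \<and> H k \<preceq> \<mu>\<^sub>2 *\<^sub>R mat 1"
    and "\<And>k. \<alpha>s k = \<alpha>"
    and "0 < \<alpha>" and "\<alpha> \<le> \<mu>\<^sub>1 / (\<mu>\<^sub>2\<^sup>2 * L)"
  shows "\<forall>k. F (w k) - F wstar \<le> (1 - \<alpha> * \<mu> * \<mu>\<^sub>1) ^ k * (F w0 - F wstar)"
proof -
  have C2: "\<And>v. F differentiable (at v)" "\<And>v. gradient F differentiable (at v)"
    using assms(1) by (auto simp: twice_continuously_differentiable_def)
  have lower: "F v + h \<bullet> gradient F v + \<mu> / 2 * (h \<bullet> h) \<le> F (v + h)"
    and upper: "F (v + h) \<le> F v + h \<bullet> gradient F v + L / 2 * (h \<bullet> h)" for v h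
  proof -
    \<comment> \<open>The point \<open>u\<close> is not known explicitly, but the Hessian bounds
      hold at every point.\<close>
    obtain u where u: "F (v + h) = F v + h \<bullet> gradient F v + (h \<bullet> (hessian F u *v h)) / 2"
      using twice_differentiable_Taylor_segment[OF C2] by blast
    have "\<mu> * (h \<bullet> h) \<le> h \<bullet> (hessian F u *v h)" "h \<bullet> (hessian F u *v h) \<le> L * (h \<bullet> h)"
      using assms(4) by (blast intro: scaleR_mat_loewner_le loewner_le_scaleR_mat)+
    with u show "F v + h \<bullet> gradient F v + \<mu> / 2 * (h \<bullet> h) \<le> F (v + h)"
      and "F (v + h) \<le> F v + h \<bullet> gradient F v + L / 2 * (h \<bullet> h)" by simp_all
  qed
  have \<mu>\<^sub>2: "0 < \<mu>\<^sub>2" using assms(12,13) by simp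
  have step: "\<alpha> * L * \<mu>\<^sub>2\<^sup>2 \<le> \<mu>\<^sub>1"
    using assms(17) \<open>0 < L\<close> \<mu>\<^sub>2 by (simp add: pos_le_divide_eq mult_ac)
  \<comment> \<open>Since \<open>\<mu>\<^sub>1 \<le> \<mu>\<^sub>2\<close>, one factor
    \<open>\<mu>\<^sub>2\<close> can be cancelled from the step length condition.\<close>
  then have "(\<alpha> * L * \<mu>\<^sub>2) * \<mu>\<^sub>2 \<le> 1 * \<mu>\<^sub>2"
    using assms(13) by (simp add: power2_eq_square mult_ac)
  then have \<alpha>L: "\<alpha> * L * \<mu>\<^sub>2 \<le> 1"
    using \<mu>\<^sub>2 by (rule mult_right_le_imp_le)
  have "\<mu> \<le> L"
    using assms(4) by (blast intro: loewner_bounds_scaleR_mat_le)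
  then have "\<alpha> * \<mu> * \<mu>\<^sub>1 \<le> \<alpha> * L * \<mu>\<^sub>2"
    using assms by (intro mult_mono) auto
  \<comment> \<open>The induction multiplies an inequality by this factor, so its sign
    matters.\<close>
  with \<alpha>L have contraction: "0 \<le> 1 - \<alpha> * \<mu> * \<mu>\<^sub>1" by simp
  \<comment> \<open>Both curvature options and all random outcomes are treated at once:
    \<open>H k\<close> stays abstract and is controlled by its Loewner bounds.\<close>
  have w_Suc: "w (Suc k) = w k - \<alpha> *\<^sub>R (H k *v gradient F (w k))" for k
    using assms(10,11,15) by (simp add: Let_def)
  have decrease: "F (w (Suc k)) - F wstar \<le> (1 - \<alpha> * \<mu> * \<mu>\<^sub>1) * (F (w k) - F wstar)" for k
  proof -
    let ?g = "gradient F (w k)"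
    have "F (w (Suc k)) \<le> F (w k) - \<alpha> * \<mu>\<^sub>1 / 2 * (?g \<bullet> ?g)"
      unfolding w_Suc using upper assms(14) assms(12) \<mu>\<^sub>2 \<open>0 < L\<close> \<open>0 < \<alpha>\<close> \<alpha>L
      by (intro quasi_newton_step_decrease[where L = L and \<mu>\<^sub>2 = \<mu>\<^sub>2]) blast+
    \<comment> \<open>The inequality of \<open>Polyak_Lojasiewicz\<close> is taken with
      \<open>wstar\<close> as the comparison point.\<close>
    also have "\<dots> \<le> F (w k) - \<alpha> * \<mu>\<^sub>1 / 2 * (2 * \<mu> * (F (w k) - F wstar))"
      using Polyak_Lojasiewicz[OF lower \<open>0 < \<mu>\<close>] assms(12) \<open>0 < \<alpha>\<close>
      by (intro diff_left_mono mult_left_mono) auto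
    finally show ?thesis by (simp add: algebra_simps)
  qed
  have "F (w k) - F wstar \<le> (1 - \<alpha> * \<mu> * \<mu>\<^sub>1) ^ k * (F w0 - F wstar)" for k
  proof (induction k)
    case 0
    then show ?case using assms(10) by simp
  next
    case (Suc k)
    then show ?case
      using order_trans[OF decrease mult_left_mono[OF Suc.IH contraction]] by (simp add: mult.assoc)
  qed
  then show ?thesis by blast
qed

end
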